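(* Let $(\mathcal{E},\rho,g_{\mathcal{E}},[\cdot,\cdot]_{\mathcal{E}})$ be a graded Courant algebroid of degree $\ell$ over a graded manifold $\mathcal{M}$ with underlying manifold $M$. Let $L\subseteq\mathcal{E}_{\mathbb{C}}$ be a generalized complex structure. Then $L$ induces a degree zero vector bundle map $\mathcal{J}:\mathcal{E}\to\mathcal{E}$ with the following properties: (i) $\mathcal{J}^2=-1_{\mathcal{E}}$ and $\mathcal{J}$ is orthogonal with respect to $\langle\cdot,\cdot\rangle_{\mathcal{E}}$, i.e. $\langle\mathcal{J}(\psi),\mathcal{J}(\psi')\rangle_{\mathcal{E}}=\langle\psi,\psi'\rangle_{\mathcal{E}}$ for all $\psi,\psi'\in\Gamma_{\mathcal{E}}(M)$; (ii) the Nijenhuis tensor $N_{\mathcal{J}}$, defined for all $\psi,\psi'\in\Gamma_{\mathcal{E}}(M)$ by $$N_{\mathcal{J}}(\psi,\psi'):=[\psi,\psi']_{\mathcal{E}}-[\mathcal{J}(\psi),\mathcal{J}(\psi')]_{\mathcal{E}}+\mathcal{J}\big([\psi,\mathcal{J}(\psi')]_{\mathcal{E}}+[\mathcal{J}(\psi),\psi']_{\mathcal{E}}\big),$$ vanishes identically; (iii) for each open $U\subseteq M$, $\Gamma_L(U)$ coincides with the $+i$ eigenspace of $\mathcal{J}_{\mathbb{C}}|_U$, and consequently $\Gamma_{\overline{L}}(U)$ coincides with the $-i$ eigenspace of $\mathcal{J}_{\mathbb{C}}|_U$.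
   Context: **Graded conventions.** Everything is $\mathbb{Z}$-graded; a graded object is a family of its homogeneous components, all elements are homogeneous, $|x|$ is the degree of $x$. A graded manifold $\mathcal{M}=(M,\mathcal{C}^\infty_{\mathcal{M}})$ is a second countable Hausdorff space $M$ with a sheaf of graded commutative associative unital $\mathbb{R}$-algebras ($fg=(-1)^{|f||g|}gf$) with local stalks, locally isomorphic to an open $\hat U\subseteq\mathbb{R}^{n_0}$ with the sheaf of formal power series, with coefficients smooth functions on open subsets of $\hat U$, in finitely many graded commuting variables of non-zero degrees. A graded vector bundle $\mathcal{E}$ over $\mathcal{M}$ is given by a sheaf $\Gamma_{\mathcal{E}}$ of graded $\mathcal{C}^\infty_{\mathcal{M}}$-modules, locally free of finite graded rank. A vector bundle map $F:\mathcal{E}\to\mathcal{E}'$ of degree $|F|$ is an $\mathbb{R}$-linear degree $|F|$ map $\Gamma_{\mathcal{E}}(M)\to\Gamma_{\mathcal{E}'}(M)$ with $F(f\psi)=(-1)^{|f||F|}fF(\psi)$; it extends uniquely to a sheaf morphism. Sections of $T\mathcal{M}$ are graded derivations of functions. Sections of $\mathcal{E}^*$ of degree $|\alpha|$ are degree $|\alpha|$ maps $\alpha:\Gamma_{\mathcal{E}}\to\mathcal{C}^\infty_{\mathcal{M}}$ with $\alpha(f\psi)=(-1)^{|\alpha||f|}f\alpha(\psi)$. $(\mathrm{d}f)(X)=(-1)^{(|X|-1)|f|}X(f)$. **Graded Courant algebroid of degree $\ell$.** A fiber-wise metric of degree $\ell$ on $\mathcal{E}$ is a vector bundle isomorphism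 $g_{\mathcal{E}}:\mathcal{E}\to\mathcal{E}^*$ of degree $\ell$ such that $\langle\psi,\psi'\rangle_{\mathcal{E}}:=(-1)^{(|\psi|+\ell)\ell}[g_{\mathcal{E}}(\psi)](\psi')$ satisfies $\langle\psi,\psi'\rangle_{\mathcal{E}}=(-1)^{(|\psi|+\ell)(|\psi'|+\ell)}\langle\psi',\psi\rangle_{\mathcal{E}}$. A graded Courant algebroid of degree $\ell$ consists of a graded vector bundle $\mathcal{E}$, a vector bundle map $\rho:\mathcal{E}\to T\mathcal{M}$ of degree $\ell$, a fiber-wise metric $g_{\mathcal{E}}$ of degree $\ell$, and an $\mathbb{R}$-bilinear bracket on $\Gamma_{\mathcal{E}}(M)$ with $|[\psi,\psi']_{\mathcal{E}}|=|\psi|+|\psi'|+\ell$ such that, with $\hat\rho(\psi):=(-1)^{(|\psi|+\ell)\ell}\rho(\psi)$, (c1) $\hat\rho(\psi)\langle\psi',\psi''\rangle_{\mathcal{E}}=\langle[\psi,\psi']_{\mathcal{E}},\psi''\rangle_{\mathcal{E}}+(-1)^{(|\psi|+\ell)(|\psi'|+\ell)}\langle\psi',[\psi,\psi'']_{\mathcal{E}}\rangle_{\mathcal{E}}$; (c2) $[\psi,\psi']_{\mathcal{E}}+(-1)^{(|\psi|+\ell)(|\psi'|+\ell)}[\psi',\psi]_{\mathcal{E}}=(-1)^{|\psi|+|\psi'|}\mathrm{D}\langle\psi,\psi'\rangle_{\mathcal{E}}$, where $\mathrm{D}:=g_{\mathcal{E}}^{-1}\circ\rho^T\circ\mathrm{d}$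 and $[\rho^T(\alpha)](\psi)=(-1)^{|\alpha|\ell}\alpha(\rho(\psi))$; (c3) $[\psi,[\psi',\psi'']_{\mathcal{E}}]_{\mathcal{E}}=[[\psi,\psi']_{\mathcal{E}},\psi'']_{\mathcal{E}}+(-1)^{(|\psi|+\ell)(|\psi'|+\ell)}[\psi',[\psi,\psi'']_{\mathcal{E}}]_{\mathcal{E}}$. **Complexification.** $(\mathcal{C}^\infty_{\mathcal{M}})_{\mathbb{C}}$ and $\Gamma_{\mathcal{E}_{\mathbb{C}}}=(\Gamma_{\mathcal{E}})_{\mathbb{C}}$ are the complexified sheaves (sections $f+ig$ with $|f|=|g|$, and $\psi+i\phi$ with $|\psi|=|\phi|$); $\mathcal{E}_{\mathbb{C}}$ is the corresponding complex graded vector bundle, and $\rho,g_{\mathcal{E}},[\cdot,\cdot]_{\mathcal{E}}$, $\langle\cdot,\cdot\rangle_{\mathcal{E}}$, as well as vector bundle maps, are extended complex (bi)linearly, denoted by a subscript $\mathbb{C}$. A complex subbundle $L\subseteq\mathcal{E}_{\mathbb{C}}$ is a subsheaf $\Gamma_L\subseteq\Gamma_{\mathcal{E}_{\mathbb{C}}}$ of graded $(\mathcal{C}^\infty_{\mathcal{M}})_{\mathbb{C}}$-submodules such that locally there is a local frame of $\mathcal{E}_{\mathbb{C}}$ part of which is a local frame of $L$. $\overline{L}$ is its image under the complex conjugation $\psi+i\phi\mapsto\psi-i\phi$. **Generalized complex structure.** A complex subbundle $L\subseteq\mathcal{E}_{\mathbb{C}}$ such that $L$ is isotropic with respect to $\langle\cdot,\cdot\rangle_{\mathcal{E}_{\mathbb{C}}}$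 (the form vanishes on pairs of sections of $L$), $\Gamma_L(M)$ is closed under $[\cdot,\cdot]_{\mathcal{E}_{\mathbb{C}}}$, and $\mathcal{E}_{\mathbb{C}}=L\oplus\overline{L}$. *)

theory Defs
  imports "HOL-Analysis.Analysis" "HOL-Library.Function_Algebras"
begin

instantiation "fun" :: (type, real_vector) real_vector
begin

definition scaleR_fun :: "real \<Rightarrow> ('a \<Rightarrow> 'b) \<Rightarrow> 'a \<Rightarrow> 'b" where
  "scaleR_fun c f = (\<lambda>x. c *\<^sub>R f x)"

instance
  by standard (simp_all add: scaleR_fun_def plus_fun_def scaleR_add_right scaleR_add_left)

end


section \<open>Graded linear algebra\<close>

text \<open>
  A graded object is the family of its homogeneous components.  The components are realised as
  linear subspaces of one ambient real vector space, any two of which meet only in \<open>0\<close>, so that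
  nonzero homogeneous elements have a well-defined degree.
  Maps are only relevant on homogeneous elements.
\<close>

record 'v gspace =
  hc :: "int \<Rightarrow> 'v set"

record 'v galg = "'v gspace" +
  gmult :: "'v \<Rightarrow> 'v \<Rightarrow> 'v"
  gone :: 'v

record ('f, 'v) gmod = "'v gspace" +
  gsmul :: "'f \<Rightarrow> 'v \<Rightarrow> 'v"

definition ksign :: "int \<Rightarrow> real" where
  "ksign k = (if even k then 1 else -1)"

definition graded_space :: "('v::real_vector, 'z) gspace_scheme \<Rightarrow> bool" where
  "graded_space V \<longleftrightarrow>
     (\<forall>k. subspace (hc V k)) \<and> (\<forall>j k. j \<noteq> k \<longrightarrow> hc V j \<inter> hc V k = {0})"

definition homog :: "('v, 'z) gspace_scheme \<Rightarrow> 'v set" where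
  "homog V = (\<Union>k. hc V k)"

text \<open>The degree \<open>|x|\<close>. It is arbitrary for \<open>x = 0\<close>, where it only occurs in signs in front of \<open>0\<close>.\<close>

definition gdeg :: "('v, 'z) gspace_scheme \<Rightarrow> 'v \<Rightarrow> int" where
  "gdeg V x = (SOME k. x \<in> hc V k)"

definition glinear ::
  "int \<Rightarrow> ('v::real_vector, 'y) gspace_scheme \<Rightarrow> ('w::real_vector, 'z) gspace_scheme
     \<Rightarrow> ('v \<Rightarrow> 'w) \<Rightarrow> bool" where
  "glinear d V W F \<longleftrightarrow>
     (\<forall>k. F ` hc V k \<subseteq> hc W (k + d) \<and>
          (\<forall>x\<in>hc V k. \<forall>y\<in>hc V k. F (x + y) = F x + F y) \<and>
          (\<forall>c. \<forall>x\<in>hc V k. F (c *\<^sub>R x) = c *\<^sub>R F x))"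

definition gbilinear ::
  "int \<Rightarrow> ('u::real_vector, 'x) gspace_scheme \<Rightarrow> ('v::real_vector, 'y) gspace_scheme
     \<Rightarrow> ('w::real_vector, 'z) gspace_scheme \<Rightarrow> ('u \<Rightarrow> 'v \<Rightarrow> 'w) \<Rightarrow> bool" where
  "gbilinear d U V W B \<longleftrightarrow>
     (\<forall>p. \<forall>x\<in>hc U p. glinear (p + d) V W (B x)) \<and>
     (\<forall>q. \<forall>y\<in>hc V q. glinear (q + d) U W (\<lambda>x. B x y))"

definition graded_algebra :: "('f::real_vector) galg \<Rightarrow> bool" where
  "graded_algebra R \<longleftrightarrow>
     graded_space R \<and> gbilinear 0 R R R (gmult R) \<and> gone R \<in> hc R 0 \<and>
     (\<forall>f\<in>homog R. gmult R (gone R) f = f) \<and>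
     (\<forall>f\<in>homog R. \<forall>g\<in>homog R. \<forall>h\<in>homog R.
        gmult R (gmult R f g) h = gmult R f (gmult R g h)) \<and>
     (\<forall>p q. \<forall>f\<in>hc R p. \<forall>g\<in>hc R q. gmult R f g = ksign (p * q) *\<^sub>R gmult R g f)"

definition galg_hom :: "('f::real_vector) galg \<Rightarrow> ('g::real_vector) galg \<Rightarrow> ('f \<Rightarrow> 'g) \<Rightarrow> bool" where
  "galg_hom R S h \<longleftrightarrow>
     glinear 0 R S h \<and> h (gone R) = gone S \<and>
     (\<forall>f\<in>homog R. \<forall>g\<in>homog R. h (gmult R f g) = gmult S (h f) (h g))"

definition graded_module :: "('f::real_vector) galg \<Rightarrow> ('f, 'v::real_vector) gmod \<Rightarrow> bool" where
  "graded_module R P \<longleftrightarrow>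
     graded_space P \<and> gbilinear 0 R P P (gsmul P) \<and>
     (\<forall>x\<in>homog P. gsmul P (gone R) x = x) \<and>
     (\<forall>f\<in>homog R. \<forall>g\<in>homog R. \<forall>x\<in>homog P.
        gsmul P (gmult R f g) x = gsmul P f (gsmul P g x))"

definition module_map ::
  "('f::real_vector) galg \<Rightarrow> int \<Rightarrow> ('f, 'v::real_vector) gmod \<Rightarrow> ('f, 'w::real_vector) gmod
     \<Rightarrow> ('v \<Rightarrow> 'w) \<Rightarrow> bool" where
  "module_map R d P Q F \<longleftrightarrow>
     glinear d P Q F \<and>
     (\<forall>p. \<forall>f\<in>hc R p. \<forall>x\<in>homog P. F (gsmul P f x) = ksign (p * d) *\<^sub>R gsmul Q f (F x))"

definition regular_module :: "'f galg \<Rightarrow> ('f, 'f) gmod" where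
  "regular_module R = \<lparr>hc = hc R, gsmul = gmult R\<rparr>"

text \<open>
  The value \<open>0\<close> outside the homogeneous elements makes equality of functions coincide with
  equality of graded maps, both here and in \<open>gder\<close>.
\<close>

definition gdual :: "('f::real_vector) galg \<Rightarrow> ('f, 'v::real_vector) gmod \<Rightarrow> ('f, 'v \<Rightarrow> 'f) gmod" where
  "gdual R P =
     \<lparr>hc = \<lambda>k. {\<alpha>. module_map R k P (regular_module R) \<alpha> \<and> (\<forall>x. x \<notin> homog P \<longrightarrow> \<alpha> x = 0)},
      gsmul = \<lambda>f \<alpha> x. gmult R f (\<alpha> x)\<rparr>"

definition gder :: "('f::real_vector) galg \<Rightarrow> ('f, 'f \<Rightarrow> 'f) gmod" where
  "gder R =
     \<lparr>hc = \<lambda>k. {X. glinear k R R X \<and>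
                (\<forall>p. \<forall>f\<in>hc R p. \<forall>g\<in>homog R.
                   X (gmult R f g) = gmult R (X f) g + ksign (k * p) *\<^sub>R gmult R f (X g)) \<and>
                (\<forall>f. f \<notin> homog R \<longrightarrow> X f = 0)},
      gsmul = \<lambda>f X g. gmult R f (X g)\<rparr>"


section \<open>Sheaves of graded algebras and modules\<close>

record ('x, 'v, 's) gsheaf =
  sect :: "'x set \<Rightarrow> 's"
  res :: "'x set \<Rightarrow> 'x set \<Rightarrow> 'v \<Rightarrow> 'v"

type_synonym ('x, 'f) alg_sheaf = "('x, 'f, 'f galg) gsheaf"
type_synonym ('x, 'f, 'v) mod_sheaf = "('x, 'v, ('f, 'v) gmod) gsheaf"

text \<open>
  Gluing is required for each family of sections of one and the same degree: a graded sheaf is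
  the family of the sheaves of its homogeneous components, not their direct sum.
\<close>

definition graded_sheaf ::
  "'x topology \<Rightarrow> ('x, 'v::real_vector, ('v, 'z) gspace_scheme) gsheaf \<Rightarrow> bool" where
  "graded_sheaf X S \<longleftrightarrow>
     (\<forall>U. openin X U \<longrightarrow> graded_space (sect S U)) \<and>
     (\<forall>U V. openin X U \<and> openin X V \<and> V \<subseteq> U \<longrightarrow> glinear 0 (sect S U) (sect S V) (res S U V)) \<and>
     (\<forall>U. openin X U \<longrightarrow> (\<forall>s\<in>homog (sect S U). res S U U s = s)) \<and>
     (\<forall>U V W. openin X U \<and> openin X V \<and> openin X W \<and> W \<subseteq> V \<and> V \<subseteq> U \<longrightarrow>
        (\<forall>s\<in>homog (sect S U). res S V W (res S U V s) = res S U W s)) \<and>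
     (\<forall>\<U> k s. (\<forall>U\<in>\<U>. openin X U \<and> s U \<in> hc (sect S U) k) \<and>
        (\<forall>U\<in>\<U>. \<forall>V\<in>\<U>. res S U (U \<inter> V) (s U) = res S V (U \<inter> V) (s V)) \<longrightarrow>
        (\<exists>!t. t \<in> hc (sect S (\<Union>\<U>)) k \<and> (\<forall>U\<in>\<U>. res S (\<Union>\<U>) U t = s U)))"

definition algebra_sheaf :: "'x topology \<Rightarrow> ('x, 'f::real_vector) alg_sheaf \<Rightarrow> bool" where
  "algebra_sheaf X A \<longleftrightarrow>
     graded_sheaf X A \<and>
     (\<forall>U. openin X U \<longrightarrow> graded_algebra (sect A U)) \<and>
     (\<forall>U V. openin X U \<and> openin X V \<and> V \<subseteq> U \<longrightarrow> galg_hom (sect A U) (sect A V) (res A U V))"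

definition module_sheaf ::
  "'x topology \<Rightarrow> ('x, 'f::real_vector) alg_sheaf \<Rightarrow> ('x, 'f, 'v::real_vector) mod_sheaf \<Rightarrow> bool" where
  "module_sheaf X A E \<longleftrightarrow>
     graded_sheaf X E \<and>
     (\<forall>U. openin X U \<longrightarrow> graded_module (sect A U) (sect E U)) \<and>
     (\<forall>U V. openin X U \<and> openin X V \<and> V \<subseteq> U \<longrightarrow>
        (\<forall>f\<in>homog (sect A U). \<forall>s\<in>homog (sect E U).
           res E U V (gsmul (sect E U) f s) = gsmul (sect E V) (res A U V f) (res E U V s)))"

definition global_sections :: "'x topology \<Rightarrow> ('x, 'v, 's) gsheaf \<Rightarrow> 's" where
  "global_sections X S = sect S (topspace X)"

subsection \<open>Stalks\<close>

definition germ ::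
  "'x topology \<Rightarrow> ('x, 'f) alg_sheaf \<Rightarrow> 'x \<Rightarrow> int \<Rightarrow> 'x set \<Rightarrow> 'f \<Rightarrow> ('x set \<times> 'f) set" where
  "germ X A x k U f =
     {(V, g). openin X V \<and> x \<in> V \<and> g \<in> hc (sect A V) k \<and>
        (\<exists>W. openin X W \<and> x \<in> W \<and> W \<subseteq> U \<inter> V \<and> res A U W f = res A V W g)}"

definition stalk :: "'x topology \<Rightarrow> ('x, 'f) alg_sheaf \<Rightarrow> 'x \<Rightarrow> int \<Rightarrow> ('x set \<times> 'f) set set" where
  "stalk X A x k = {germ X A x k U f | U f. openin X U \<and> x \<in> U \<and> f \<in> hc (sect A U) k}"

text \<open>
  Graded ideals of the stalk at \<open>x\<close>. The operations of the stalk are those of representatives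
  on a common neighbourhood, which any two germs possess.
\<close>

definition stalk_ideal ::
  "'x topology \<Rightarrow> ('x, 'f::real_vector) alg_sheaf \<Rightarrow> 'x \<Rightarrow> (int \<Rightarrow> ('x set \<times> 'f) set set) \<Rightarrow> bool" where
  "stalk_ideal X A x I \<longleftrightarrow>
     (\<forall>k. I k \<subseteq> stalk X A x k) \<and>
     (\<forall>U. openin X U \<and> x \<in> U \<longrightarrow>
        (\<forall>k. germ X A x k U 0 \<in> I k) \<and>
        (\<forall>k. \<forall>f\<in>hc (sect A U) k. \<forall>g\<in>hc (sect A U) k.
           germ X A x k U f \<in> I k \<and> germ X A x k U g \<in> I k \<longrightarrow> germ X A x k U (f + g) \<in> I k) \<and>
        (\<forall>j k. \<forall>h\<in>hc (sect A U) j. \<forall>f\<in>hc (sect A U) k.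
           germ X A x k U f \<in> I k \<longrightarrow>
           germ X A x (j + k) U (gmult (sect A U) h f) \<in> I (j + k)))"

definition proper_stalk_ideal ::
  "'x topology \<Rightarrow> ('x, 'f::real_vector) alg_sheaf \<Rightarrow> 'x \<Rightarrow> (int \<Rightarrow> ('x set \<times> 'f) set set) \<Rightarrow> bool" where
  "proper_stalk_ideal X A x I \<longleftrightarrow> stalk_ideal X A x I \<and> (\<exists>k. I k \<noteq> stalk X A x k)"

definition local_stalk :: "'x topology \<Rightarrow> ('x, 'f::real_vector) alg_sheaf \<Rightarrow> 'x \<Rightarrow> bool" where
  "local_stalk X A x \<longleftrightarrow>
     (\<exists>!I. proper_stalk_ideal X A x I \<and>
        (\<forall>I'. proper_stalk_ideal X A x I' \<and> (\<forall>k. I k \<subseteq> I' k) \<longrightarrow> I' = I))"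


section \<open>Graded manifolds\<close>

text \<open>
  Points of \<open>\<real>\<^sup>n\<close> are functions \<open>nat \<Rightarrow> real\<close> vanishing from index \<open>n\<close> on,
  as in \<^const>\<open>Euclidean_space\<close>; in contrast to the types of class \<^class>\<open>euclidean_space\<close>,
  \<open>n = 0\<close> is included.
\<close>

primrec continuously_diff :: "nat \<Rightarrow> nat \<Rightarrow> (nat \<Rightarrow> real) set \<Rightarrow> ((nat \<Rightarrow> real) \<Rightarrow> real) \<Rightarrow> bool" where
  "continuously_diff 0 n V f \<longleftrightarrow>
     continuous_map (subtopology (Euclidean_space n) V) euclideanreal f"
| "continuously_diff (Suc r) n V f \<longleftrightarrow>
     continuous_map (subtopology (Euclidean_space n) V) euclideanreal f \<and>
     (\<forall>i<n. \<exists>g. continuously_diff r n V g \<and>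
        (\<forall>x\<in>V. ((\<lambda>t. f (x(i := t))) has_real_derivative g x) (at (x i))))"

definition smooth_fun :: "nat \<Rightarrow> (nat \<Rightarrow> real) set \<Rightarrow> ((nat \<Rightarrow> real) \<Rightarrow> real) \<Rightarrow> bool" where
  "smooth_fun n V f \<longleftrightarrow> (\<forall>r. continuously_diff r n V f)"

text \<open>
  Formal power series in graded commuting variables \<open>\<xi>\<^sub>0, \<dots>, \<xi>\<^sub>m\<^sub>-\<^sub>1\<close>, whose degrees form the list
  \<open>d\<close>. The exponents of the odd variables are at most 1. The sign \<open>mon_sign d q r\<close> is that in
  \<open>\<xi>\<^sup>q \<xi>\<^sup>r = \<plusminus> \<xi>\<^sup>q\<^sup>+\<^sup>r\<close>: each \<open>\<xi>\<^sub>j\<close> of the second factor moves past the \<open>\<xi>\<^sub>i\<close>, \<open>i > j\<close>, of the first.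
\<close>

definition mon_exps :: "int list \<Rightarrow> (nat \<Rightarrow> nat) set" where
  "mon_exps d = {p. (\<forall>i\<ge>length d. p i = 0) \<and> (\<forall>i<length d. odd (d ! i) \<longrightarrow> p i \<le> 1)}"

definition mon_deg :: "int list \<Rightarrow> (nat \<Rightarrow> nat) \<Rightarrow> int" where
  "mon_deg d p = (\<Sum>i<length d. int (p i) * d ! i)"

definition mon_sign :: "int list \<Rightarrow> (nat \<Rightarrow> nat) \<Rightarrow> (nat \<Rightarrow> nat) \<Rightarrow> real" where
  "mon_sign d q r = ksign (\<Sum>i<length d. \<Sum>j<i. int (q i) * d ! i * (int (r j) * d ! j))"

definition model_sheaf ::
  "nat \<Rightarrow> int list \<Rightarrow> (nat \<Rightarrow> real, (nat \<Rightarrow> nat) \<Rightarrow> (nat \<Rightarrow> real) \<Rightarrow> real) alg_sheaf" where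
  "model_sheaf n d =
     \<lparr>sect = \<lambda>V.
        \<lparr>hc = \<lambda>k. {s. (\<forall>p\<in>mon_exps d. smooth_fun n V (s p)) \<and>
                     (\<forall>p x. s p x \<noteq> 0 \<longrightarrow> p \<in> mon_exps d \<and> mon_deg d p = k \<and> x \<in> V)},
         gmult = \<lambda>s t p x. if p \<in> mon_exps d
           then (\<Sum>q\<in>{q. \<forall>i. q i \<le> p i}. mon_sign d q (\<lambda>i. p i - q i) * s q x * t (\<lambda>i. p i - q i) x)
           else 0,
         gone = \<lambda>p x. if p = (\<lambda>i. 0) \<and> x \<in> V then 1 else 0\<rparr>,
      res = \<lambda>V W s p x. if x \<in> W then s p x else 0\<rparr>"

definition graded_chart ::
  "'x topology \<Rightarrow> ('x, 'f::real_vector) alg_sheaf \<Rightarrow> nat \<Rightarrow> int list \<Rightarrow> 'x set \<Rightarrow> (nat \<Rightarrow> real) set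
     \<Rightarrow> ('x \<Rightarrow> nat \<Rightarrow> real) \<Rightarrow> ('x set \<Rightarrow> 'f \<Rightarrow> (nat \<Rightarrow> nat) \<Rightarrow> (nat \<Rightarrow> real) \<Rightarrow> real) \<Rightarrow> bool" where
  "graded_chart X A n d U U' \<phi> \<Phi> \<longleftrightarrow>
     openin X U \<and> openin (Euclidean_space n) U' \<and>
     homeomorphic_map (subtopology X U) (subtopology (Euclidean_space n) U') \<phi> \<and>
     (\<forall>V. openin X V \<and> V \<subseteq> U \<longrightarrow>
        galg_hom (sect A V) (sect (model_sheaf n d) (\<phi> ` V)) (\<Phi> V) \<and>
        (\<forall>k. bij_betw (\<Phi> V) (hc (sect A V) k) (hc (sect (model_sheaf n d) (\<phi> ` V)) k))) \<and>
     (\<forall>V W. openin X V \<and> openin X W \<and> W \<subseteq> V \<and> V \<subseteq> U \<longrightarrow>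
        (\<forall>f\<in>homog (sect A V).
           \<Phi> W (res A V W f) = res (model_sheaf n d) (\<phi> ` V) (\<phi> ` W) (\<Phi> V f)))"

definition graded_manifold :: "'x topology \<Rightarrow> ('x, 'f::real_vector) alg_sheaf \<Rightarrow> bool" where
  "graded_manifold X A \<longleftrightarrow>
     second_countable X \<and> Hausdorff_space X \<and> algebra_sheaf X A \<and>
     (\<forall>x\<in>topspace X. local_stalk X A x) \<and>
     (\<exists>n d. 0 \<notin> set d \<and>
        (\<forall>x\<in>topspace X. \<exists>U U' \<phi> \<Phi>. x \<in> U \<and> graded_chart X A n d U U' \<phi> \<Phi>))"


section \<open>Graded vector bundles\<close>

text \<open>A local frame is given as a list of sections together with their degrees.\<close>

definition local_frame ::
  "'x topology \<Rightarrow> ('x, 'f::real_vector) alg_sheaf \<Rightarrow> ('x, 'f, 'v::real_vector) mod_sheaf \<Rightarrow> 'x set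
     \<Rightarrow> (int \<times> 'v) list \<Rightarrow> bool" where
  "local_frame X A E V es \<longleftrightarrow>
     openin X V \<and> (\<forall>(k, e)\<in>set es. e \<in> hc (sect E V) k) \<and>
     (\<forall>W k. openin X W \<and> W \<subseteq> V \<longrightarrow>
        (\<forall>s\<in>hc (sect E W) k.
           \<exists>!fs. length fs = length es \<and>
             (\<forall>i<length es. fs ! i \<in> hc (sect A W) (k - fst (es ! i))) \<and>
             s = (\<Sum>i<length es. gsmul (sect E W) (fs ! i) (res E V W (snd (es ! i))))))"

definition graded_vector_bundle ::
  "'x topology \<Rightarrow> ('x, 'f::real_vector) alg_sheaf \<Rightarrow> ('x, 'f, 'v::real_vector) mod_sheaf \<Rightarrow> bool" where
  "graded_vector_bundle X A E \<longleftrightarrow>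
     module_sheaf X A E \<and> (\<forall>x\<in>topspace X. \<exists>V es. x \<in> V \<and> local_frame X A E V es)"

text \<open>
  A vector bundle map is a \<^const>\<open>module_map\<close> between the modules of global sections.
  Its extension to a sheaf morphism is the following.
\<close>

definition sheaf_extension ::
  "'x topology \<Rightarrow> ('x, 'f::real_vector) alg_sheaf \<Rightarrow> int \<Rightarrow> ('x, 'f, 'v::real_vector) mod_sheaf
     \<Rightarrow> ('x, 'f, 'w::real_vector) mod_sheaf \<Rightarrow> ('v \<Rightarrow> 'w) \<Rightarrow> ('x set \<Rightarrow> 'v \<Rightarrow> 'w) \<Rightarrow> bool" where
  "sheaf_extension X A d E E' F FU \<longleftrightarrow>
     (\<forall>U. openin X U \<longrightarrow> module_map (sect A U) d (sect E U) (sect E' U) (FU U)) \<and>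
     (\<forall>U V. openin X U \<and> openin X V \<and> V \<subseteq> U \<longrightarrow>
        (\<forall>s\<in>homog (sect E U). FU V (res E U V s) = res E' U V (FU U s))) \<and>
     (\<forall>s\<in>homog (global_sections X E). FU (topspace X) s = F s)"


section \<open>Graded Courant algebroids\<close>

text \<open>
  In this section \<open>R\<close> is the algebra of global functions and \<open>P\<close> the module of global sections
  of the vector bundle; \<^term>\<open>gder R\<close> and \<^term>\<open>gdual R P\<close> are the global sections of the tangent
  bundle and of the dual bundle.
\<close>

definition pairing :: "int \<Rightarrow> ('f::real_vector, 'v) gmod \<Rightarrow> ('v \<Rightarrow> 'v \<Rightarrow> 'f) \<Rightarrow> 'v \<Rightarrow> 'v \<Rightarrow> 'f" where
  "pairing ell P g x y = ksign ((gdeg P x + ell) * ell) *\<^sub>R g x y"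

definition fiberwise_metric ::
  "('f::real_vector) galg \<Rightarrow> int \<Rightarrow> ('f, 'v::real_vector) gmod \<Rightarrow> ('v \<Rightarrow> 'v \<Rightarrow> 'f) \<Rightarrow> bool" where
  "fiberwise_metric R ell P g \<longleftrightarrow>
     module_map R ell P (gdual R P) g \<and>
     (\<forall>k. bij_betw g (hc P k) (hc (gdual R P) (k + ell))) \<and>
     (\<forall>p q. \<forall>x\<in>hc P p. \<forall>y\<in>hc P q.
        pairing ell P g x y = ksign ((p + ell) * (q + ell)) *\<^sub>R pairing ell P g y x)"

definition anchor_hat ::
  "int \<Rightarrow> ('f::real_vector, 'v) gmod \<Rightarrow> ('v \<Rightarrow> 'f \<Rightarrow> 'f) \<Rightarrow> 'v \<Rightarrow> 'f \<Rightarrow> 'f" where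
  "anchor_hat ell P \<rho> x = ksign ((gdeg P x + ell) * ell) *\<^sub>R \<rho> x"

definition differential :: "('f::real_vector) galg \<Rightarrow> 'f \<Rightarrow> ('f \<Rightarrow> 'f) \<Rightarrow> 'f" where
  "differential R f =
     (\<lambda>X. if X \<in> homog (gder R) then ksign ((gdeg (gder R) X - 1) * gdeg R f) *\<^sub>R X f else 0)"

definition anchor_transpose ::
  "('f::real_vector) galg \<Rightarrow> int \<Rightarrow> ('f, 'v::real_vector) gmod \<Rightarrow> ('v \<Rightarrow> 'f \<Rightarrow> 'f)
     \<Rightarrow> (('f \<Rightarrow> 'f) \<Rightarrow> 'f) \<Rightarrow> 'v \<Rightarrow> 'f" where
  "anchor_transpose R ell P \<rho> \<alpha> =
     (\<lambda>x. if x \<in> homog P then ksign (gdeg (gdual R (gder R)) \<alpha> * ell) *\<^sub>R \<alpha> (\<rho> x) else 0)"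

definition courant_D ::
  "('f::real_vector) galg \<Rightarrow> int \<Rightarrow> ('f, 'v::real_vector) gmod \<Rightarrow> ('v \<Rightarrow> 'f \<Rightarrow> 'f)
     \<Rightarrow> ('v \<Rightarrow> 'v \<Rightarrow> 'f) \<Rightarrow> 'f \<Rightarrow> 'v" where
  "courant_D R ell P \<rho> g =
     the_inv_into (homog P) g \<circ> anchor_transpose R ell P \<rho> \<circ> differential R"

definition courant_axioms ::
  "('f::real_vector) galg \<Rightarrow> int \<Rightarrow> ('f, 'v::real_vector) gmod \<Rightarrow> ('v \<Rightarrow> 'f \<Rightarrow> 'f)
     \<Rightarrow> ('v \<Rightarrow> 'v \<Rightarrow> 'f) \<Rightarrow> ('v \<Rightarrow> 'v \<Rightarrow> 'v) \<Rightarrow> bool" where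
  "courant_axioms R ell P \<rho> g br \<longleftrightarrow>
     (\<forall>p q. \<forall>x\<in>hc P p. \<forall>y\<in>hc P q. \<forall>z\<in>homog P.
        anchor_hat ell P \<rho> x (pairing ell P g y z) =
          pairing ell P g (br x y) z + ksign ((p + ell) * (q + ell)) *\<^sub>R pairing ell P g y (br x z)) \<and>
     (\<forall>p q. \<forall>x\<in>hc P p. \<forall>y\<in>hc P q.
        br x y + ksign ((p + ell) * (q + ell)) *\<^sub>R br y x =
          ksign (p + q) *\<^sub>R courant_D R ell P \<rho> g (pairing ell P g x y)) \<and>
     (\<forall>p q. \<forall>x\<in>hc P p. \<forall>y\<in>hc P q. \<forall>z\<in>homog P.
        br x (br y z) = br (br x y) z + ksign ((p + ell) * (q + ell)) *\<^sub>R br y (br x z))"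

definition graded_courant_algebroid ::
  "'x topology \<Rightarrow> ('x, 'f::real_vector) alg_sheaf \<Rightarrow> int \<Rightarrow> ('x, 'f, 'v::real_vector) mod_sheaf
     \<Rightarrow> ('v \<Rightarrow> 'f \<Rightarrow> 'f) \<Rightarrow> ('v \<Rightarrow> 'v \<Rightarrow> 'f) \<Rightarrow> ('v \<Rightarrow> 'v \<Rightarrow> 'v) \<Rightarrow> bool" where
  "graded_courant_algebroid X A ell E \<rho> g br \<longleftrightarrow>
     (let R = global_sections X A; P = global_sections X E in
       graded_vector_bundle X A E \<and>
       module_map R ell P (gder R) \<rho> \<and>
       fiberwise_metric R ell P g \<and>
       gbilinear ell P P P br \<and>
       courant_axioms R ell P \<rho> g br)"


section \<open>Complexification\<close>

text \<open>The pair \<open>(a, b)\<close> stands for \<open>a + i b\<close>.\<close>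

definition cx_i :: "'v::real_vector \<times> 'v \<Rightarrow> 'v \<times> 'v" where
  "cx_i = (\<lambda>(a, b). (- b, a))"

definition cx_conj :: "'v::real_vector \<times> 'v \<Rightarrow> 'v \<times> 'v" where
  "cx_conj = (\<lambda>(a, b). (a, - b))"

definition cx_map :: "('v \<Rightarrow> 'w) \<Rightarrow> 'v \<times> 'v \<Rightarrow> 'w \<times> 'w" where
  "cx_map F = (\<lambda>(a, b). (F a, F b))"

definition cx_bilin ::
  "('u \<Rightarrow> 'v \<Rightarrow> 'w::real_vector) \<Rightarrow> 'u \<times> 'u \<Rightarrow> 'v \<times> 'v \<Rightarrow> 'w \<times> 'w" where
  "cx_bilin B = (\<lambda>(a, b) (c, d). (B a c - B b d, B a d + B b c))"

definition cx_alg :: "('f::real_vector) galg \<Rightarrow> ('f \<times> 'f) galg" where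
  "cx_alg R = \<lparr>hc = \<lambda>k. hc R k \<times> hc R k, gmult = cx_bilin (gmult R), gone = (gone R, 0)\<rparr>"

definition cx_mod :: "('f, 'v::real_vector) gmod \<Rightarrow> ('f \<times> 'f, 'v \<times> 'v) gmod" where
  "cx_mod P = \<lparr>hc = \<lambda>k. hc P k \<times> hc P k, gsmul = cx_bilin (gsmul P)\<rparr>"

definition cx_alg_sheaf :: "('x, 'f::real_vector) alg_sheaf \<Rightarrow> ('x, 'f \<times> 'f) alg_sheaf" where
  "cx_alg_sheaf A = \<lparr>sect = \<lambda>U. cx_alg (sect A U), res = \<lambda>U V. cx_map (res A U V)\<rparr>"

definition cx_mod_sheaf ::
  "('x, 'f, 'v::real_vector) mod_sheaf \<Rightarrow> ('x, 'f \<times> 'f, 'v \<times> 'v) mod_sheaf" where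
  "cx_mod_sheaf E = \<lparr>sect = \<lambda>U. cx_mod (sect E U), res = \<lambda>U V. cx_map (res E U V)\<rparr>"

text \<open>A subsheaf is given by the sets \<open>L U k\<close> of its sections of degree \<open>k\<close> over \<open>U\<close>.\<close>

definition restrict_sheaf ::
  "('x, 'f, 'v) mod_sheaf \<Rightarrow> ('x set \<Rightarrow> int \<Rightarrow> 'v set) \<Rightarrow> ('x, 'f, 'v) mod_sheaf" where
  "restrict_sheaf E L = \<lparr>sect = \<lambda>U. (sect E U)\<lparr>hc := L U\<rparr>, res = res E\<rparr>"

definition complex_subbundle ::
  "'x topology \<Rightarrow> ('x, 'f::real_vector) alg_sheaf \<Rightarrow> ('x, 'f, 'v::real_vector) mod_sheaf
     \<Rightarrow> ('x set \<Rightarrow> int \<Rightarrow> ('v \<times> 'v) set) \<Rightarrow> bool" where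
  "complex_subbundle X A E L \<longleftrightarrow>
     (\<forall>U k. openin X U \<longrightarrow> L U k \<subseteq> hc (sect (cx_mod_sheaf E) U) k) \<and>
     module_sheaf X (cx_alg_sheaf A) (restrict_sheaf (cx_mod_sheaf E) L) \<and>
     (\<forall>x\<in>topspace X. \<exists>V ls es. x \<in> V \<and>
        local_frame X (cx_alg_sheaf A) (cx_mod_sheaf E) V (ls @ es) \<and>
        local_frame X (cx_alg_sheaf A) (restrict_sheaf (cx_mod_sheaf E) L) V ls)"

definition conj_subsheaf ::
  "('x set \<Rightarrow> int \<Rightarrow> ('v::real_vector \<times> 'v) set) \<Rightarrow> 'x set \<Rightarrow> int \<Rightarrow> ('v \<times> 'v) set" where
  "conj_subsheaf L U k = cx_conj ` L U k"

definition generalized_complex_structure ::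
  "'x topology \<Rightarrow> ('x, 'f::real_vector) alg_sheaf \<Rightarrow> int \<Rightarrow> ('x, 'f, 'v::real_vector) mod_sheaf
     \<Rightarrow> ('v \<Rightarrow> 'v \<Rightarrow> 'f) \<Rightarrow> ('v \<Rightarrow> 'v \<Rightarrow> 'v) \<Rightarrow> ('x set \<Rightarrow> int \<Rightarrow> ('v \<times> 'v) set) \<Rightarrow> bool" where
  "generalized_complex_structure X A ell E g br L \<longleftrightarrow>
     complex_subbundle X A E L \<and>
     (\<forall>p q. \<forall>x\<in>L (topspace X) p. \<forall>y\<in>L (topspace X) q.
        cx_bilin (pairing ell (global_sections X E) g) x y = 0) \<and>
     (\<forall>p q. \<forall>x\<in>L (topspace X) p. \<forall>y\<in>L (topspace X) q.
        cx_bilin br x y \<in> L (topspace X) (p + q + ell)) \<and>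
     (\<forall>U k. openin X U \<longrightarrow>
        hc (sect (cx_mod_sheaf E) U) k = {x + y | x y. x \<in> L U k \<and> y \<in> conj_subsheaf L U k} \<and>
        L U k \<inter> conj_subsheaf L U k = {0})"

definition nijenhuis :: "('v::real_vector \<Rightarrow> 'v \<Rightarrow> 'v) \<Rightarrow> ('v \<Rightarrow> 'v) \<Rightarrow> 'v \<Rightarrow> 'v \<Rightarrow> 'v" where
  "nijenhuis br J x y = br x y - br (J x) (J y) + J (br x (J y) + br (J x) y)"

end

theory Submission
  imports Defs
begin

text \<open>
  Over every open set a section \<open>a\<close> of \<open>E\<close> is, as a real section of the complexification, a sum
  \<open>x + y\<close> with \<open>x\<close> in \<open>L\<close> and \<open>y\<close> in the conjugate of \<open>L\<close>. Since \<open>a\<close> is fixed by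
  conjugation and the sum is direct, \<open>y\<close> is the conjugate of \<open>x\<close>, so \<open>a\<close> is twice the real part
  of exactly one \<open>x\<close> in \<open>L\<close>. Writing \<open>2 x = a - i J a\<close> defines \<open>J\<close>; in other words
  \<open>L\<close> is the graph \<open>{a - i J a}\<close>, which is the \<open>+i\<close> eigenspace of a complex structure.

  Under this graph description every property of \<open>J\<close> is read off from one of \<open>L\<close>
  (\<open>graph_iff\<close>). Closure under real functions and under restriction makes \<open>J\<close> a map of sheaves
  of modules, and closure under multiplication by \<open>i\<close> gives \<open>J (J a) = - a\<close>. The real part of
  \<open>\<langle>a - i J a, b - i J b\<rangle> = 0\<close> is orthogonality. Finally
  \<open>[a - i J a, b - i J b] = u - i w\<close>, with \<open>u = [a, b] - [J a, J b]\<close> and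
  \<open>w = [a, J b] + [J a, b]\<close>, lies in \<open>L\<close> precisely if \<open>J u = w\<close>, and then the Nijenhuis tensor
  is \<open>u + J w = u + J (J u) = 0\<close>.

  The construction is canonical on each open set, so restriction, which preserves \<open>L\<close>,
  intertwines the maps \<open>J\<close> over different open sets; the map over the whole space is the
  vector bundle map, and the others are its extension to a sheaf morphism.
\<close>

section \<open>Graded linear maps\<close>

lemma glinear_zero:
  assumes "glinear d V W F" and "x \<in> hc V k"
  shows "F 0 = 0"
proof -
  have "F (0 *\<^sub>R x) = 0 *\<^sub>R F x"
    using assms unfolding glinear_def by blast
  then show ?thesis by simp
qed

lemma glinear_minus:
  assumes "glinear d V W F" and "x \<in> hc V k"
  shows "F (- x) = - F x"
proof -
  have "F ((-1) *\<^sub>R x) = (-1) *\<^sub>R F x"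
    using assms unfolding glinear_def by blast
  then show ?thesis by simp
qed

lemma glinear_mem: "glinear d V W F \<Longrightarrow> x \<in> hc V k \<Longrightarrow> F x \<in> hc W (k + d)"
  unfolding glinear_def by blast

lemma gbilinear_mem:
  assumes "gbilinear d U V W B" and "x \<in> hc U p" and "y \<in> hc V q"
  shows "B x y \<in> hc W (p + q + d)"
proof -
  have "glinear (p + d) V W (B x)"
    using assms unfolding gbilinear_def by blast
  then have "B x y \<in> hc W (q + (p + d))"
    using assms(3) by (rule glinear_mem)
  then show ?thesis by (simp add: algebra_simps)
qed

lemma gbilinear_zero_left:
  assumes "gbilinear d U V W B" and "x \<in> hc U p" and "y \<in> hc V q"
  shows "B 0 y = 0"
proof -
  have "glinear (q + d) U W (\<lambda>x. B x y)"
    using assms unfolding gbilinear_def by blast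
  from glinear_zero[OF this assms(2)] show ?thesis .
qed

lemma gbilinear_minus_left:
  assumes "gbilinear d U V W B" and "x \<in> hc U p" and "y \<in> hc V q"
  shows "B (- x) y = - B x y"
proof -
  have "glinear (q + d) U W (\<lambda>x. B x y)"
    using assms unfolding gbilinear_def by blast
  from glinear_minus[OF this assms(2)] show ?thesis .
qed

lemma gbilinear_minus_right:
  assumes "gbilinear d U V W B" and "x \<in> hc U p" and "y \<in> hc V q"
  shows "B x (- y) = - B x y"
proof -
  have "glinear (p + d) V W (B x)"
    using assms unfolding gbilinear_def by blast
  from glinear_minus[OF this assms(3)] show ?thesis .
qed

lemma graded_space_subspace: "graded_space V \<Longrightarrow> subspace (hc V k)"
  unfolding graded_space_def by blast

lemma homogI: "x \<in> hc V k \<Longrightarrow> x \<in> homog V"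
  unfolding homog_def by blast

lemma homogE:
  assumes "x \<in> homog V"
  obtains k where "x \<in> hc V k"
  using assms unfolding homog_def by blast


section \<open>Polarizations of a graded space\<close>

text \<open>
  The splitting of the complexified sections into \<open>L\<close> and its conjugate, over one open set.
  A complex subspace is encoded as a real one that is stable under \<open>i\<close>, since pairs only carry
  a real vector space structure.
\<close>

definition graded_polarization ::
  "('v::real_vector, 'z) gspace_scheme \<Rightarrow> (int \<Rightarrow> ('v \<times> 'v) set) \<Rightarrow> bool" where
  "graded_polarization V L \<longleftrightarrow>
     graded_space V \<and>
     (\<forall>k. subspace (L k) \<and> (\<forall>x\<in>L k. cx_i x \<in> L k) \<and>
        hc V k \<times> hc V k = {x + y | x y. x \<in> L k \<and> y \<in> cx_conj ` L k} \<and>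
        L k \<inter> cx_conj ` L k = {0})"

text \<open>
  The quantifier over the degree does not spoil uniqueness: \<open>a \<noteq> 0\<close> occurs in one degree
  only, and for \<open>a = 0\<close> every degree yields \<open>0\<close>.
\<close>

definition polarization_J :: "(int \<Rightarrow> ('v::real_vector \<times> 'v) set) \<Rightarrow> 'v \<Rightarrow> 'v" where
  "polarization_J L a = (THE b. \<exists>k. (a, - b) \<in> L k)"

lemma polarization_subset:
  assumes "graded_polarization V L"
  shows "L k \<subseteq> hc V k \<times> hc V k"
proof
  fix x assume "x \<in> L k"
  moreover have "0 \<in> cx_conj ` L k"
    using assms unfolding graded_polarization_def by blast
  ultimately have "x + 0 \<in> {x + y | x y. x \<in> L k \<and> y \<in> cx_conj ` L k}"
    by blast
  then show "x \<in> hc V k \<times> hc V k"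
    using assms unfolding graded_polarization_def by simp
qed

text \<open>
  Conjugation maps a purely imaginary element to its negative, so such an element of \<open>L\<close> also
  lies in the conjugate of \<open>L\<close>.
\<close>

lemma polarization_imaginary_zero:
  assumes pol: "graded_polarization V L" and mem: "(0, b) \<in> L k"
  shows "b = 0"
proof -
  have sub: "subspace (L k)"
    using pol unfolding graded_polarization_def by blast
  have "- (0, b) \<in> L k"
    using subspace_neg[OF sub mem] .
  then have "cx_conj (- (0, b)) \<in> cx_conj ` L k"
    by blast
  then have "(0, b) \<in> cx_conj ` L k"
    by (simp add: cx_conj_def)
  then have "(0, b) \<in> L k \<inter> cx_conj ` L k"
    using mem by blast
  moreover have "L k \<inter> cx_conj ` L k = {0}"
    using pol unfolding graded_polarization_def by blast
  ultimately show ?thesis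
    by (simp add: zero_prod_def)
qed

text \<open>
  Write \<open>(a, 0) = x + cx_conj y\<close> with \<open>x\<close> and \<open>y\<close> in \<open>L\<close>. Conjugation preserves real
  parts, so \<open>x + y\<close> is an element of \<open>L\<close> with real part \<open>a\<close>.
\<close>

lemma polarization_exists:
  assumes pol: "graded_polarization V L" and a: "a \<in> hc V k"
  shows "\<exists>b. (a, - b) \<in> L k"
proof -
  have sub: "subspace (L k)" and "graded_space V"
    using pol unfolding graded_polarization_def by blast+
  then have "0 \<in> hc V k"
    by (simp add: graded_space_subspace subspace_0)
  then have "(a, 0) \<in> {x + y | x y. x \<in> L k \<and> y \<in> cx_conj ` L k}"
    using pol a unfolding graded_polarization_def by blast
  then obtain x y where xy: "x \<in> L k" "y \<in> L k" "(a, 0) = x + cx_conj y"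
    by blast
  then have "x + y \<in> L k"
    using subspace_add[OF sub] by blast
  moreover have "fst (x + y) = a"
    using arg_cong[OF xy(3), of fst] by (simp add: cx_conj_def split: prod.splits)
  ultimately have "(a, - (- snd (x + y))) \<in> L k"
    by (metis minus_minus prod.collapse)
  then show ?thesis by blast
qed

lemma polarization_unique:
  assumes pol: "graded_polarization V L" and b: "(a, - b) \<in> L j" and c: "(a, - c) \<in> L k"
  shows "b = c"
proof -
  have gs: "graded_space V" and sub: "\<And>k. subspace (L k)"
    using pol unfolding graded_polarization_def by blast+
  show ?thesis
  proof (cases "j = k")
    case True
    then have "(a, - b) - (a, - c) \<in> L k"
      using subspace_diff[OF sub] b c by blast
    then have "(0, c - b) \<in> L k"
      by simp
    from polarization_imaginary_zero[OF pol this] show ?thesis by simp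
  next
    case False
    have "a \<in> hc V j" "a \<in> hc V k"
      using polarization_subset[OF pol] b c by blast+
    then have "a = 0"
      using gs False unfolding graded_space_def by blast
    then have "- b = 0" "- c = 0"
      using polarization_imaginary_zero[OF pol] b c by blast+
    then show ?thesis by simp
  qed
qed

text \<open>\<open>L\<close> is the graph of \<open>- J\<close>: all properties of \<open>J\<close> are read off from this equivalence.\<close>

lemma graph_iff:
  assumes pol: "graded_polarization V L"
  shows "(a, b) \<in> L k \<longleftrightarrow> a \<in> hc V k \<and> b = - polarization_J L a"
proof -
  have J: "polarization_J L a = c" if "(a, - c) \<in> L k" for c
    unfolding polarization_J_def
    using that polarization_unique[OF pol] by (intro the_equality) blast+
  show ?thesis
  proof
    assume ab: "(a, b) \<in> L k"
    then have "polarization_J L a = - b"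
      by (intro J) simp
    then show "a \<in> hc V k \<and> b = - polarization_J L a"
      using polarization_subset[OF pol] ab by auto
  next
    assume ab: "a \<in> hc V k \<and> b = - polarization_J L a"
    then obtain c where c: "(a, - c) \<in> L k"
      using polarization_exists[OF pol] by blast
    then show "(a, b) \<in> L k"
      using J[OF c] ab by simp
  qed
qed

lemma polarization_J_graph:
  "graded_polarization V L \<Longrightarrow> a \<in> hc V k \<Longrightarrow> (a, - polarization_J L a) \<in> L k"
  by (simp add: graph_iff)

lemma polarization_J_eqI:
  "graded_polarization V L \<Longrightarrow> (a, - b) \<in> L k \<Longrightarrow> polarization_J L a = b"
  by (simp add: graph_iff)

lemma polarization_J_mem:
  assumes pol: "graded_polarization V L" and a: "a \<in> hc V k"
  shows "polarization_J L a \<in> hc V k"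
proof -
  have "- polarization_J L a \<in> hc V k"
    using polarization_J_graph[OF pol a] polarization_subset[OF pol] by blast
  moreover have "subspace (hc V k)"
    using pol graded_space_subspace unfolding graded_polarization_def by blast
  ultimately show ?thesis
    using subspace_neg by fastforce
qed

lemma polarization_J_glinear:
  assumes pol: "graded_polarization V L"
  shows "glinear 0 V V (polarization_J L)"
proof -
  have sub: "subspace (L k)" for k
    using pol unfolding graded_polarization_def by blast
  have "polarization_J L (x + y) = polarization_J L x + polarization_J L y"
    if "x \<in> hc V k" "y \<in> hc V k" for x y k
    using subspace_add[OF sub polarization_J_graph[OF pol that(1)] polarization_J_graph[OF pol that(2)]]
    by (intro polarization_J_eqI[OF pol, where k = k]) simp
  moreover have "polarization_J L (c *\<^sub>R x) = c *\<^sub>R polarization_J L x"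
    if "x \<in> hc V k" for c x k
    using subspace_scale[OF sub polarization_J_graph[OF pol that], of c]
    by (intro polarization_J_eqI[OF pol, where k = k]) simp
  ultimately show ?thesis
    unfolding glinear_def using polarization_J_mem[OF pol] by auto
qed

lemma polarization_J_square:
  assumes pol: "graded_polarization V L" and a: "a \<in> hc V k"
  shows "polarization_J L (polarization_J L a) = - a"
proof (rule polarization_J_eqI[OF pol])
  have "cx_i (a, - polarization_J L a) \<in> L k"
    using pol polarization_J_graph[OF pol a] unfolding graded_polarization_def by blast
  then show "(polarization_J L a, - (- a)) \<in> L k"
    by (simp add: cx_i_def)
qed

text \<open>
  One component of the equation \<open>J\<^sub>\<complex> x = i x\<close> already says that \<open>x\<close> lies on the graph;
  the other one follows because \<open>J\<close> squares to \<open>- 1\<close>.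
\<close>

lemma polarization_eigenspace:
  fixes L :: "int \<Rightarrow> ('v::real_vector \<times> 'v) set"
  assumes pol: "graded_polarization V L"
  shows "L k = {x \<in> hc V k \<times> hc V k. cx_map (polarization_J L) x = cx_i x}"
proof (rule set_eqI)
  fix x :: "'v \<times> 'v"
  obtain a b where x: "x = (a, b)" by (cases x)
  have J: "glinear 0 V V (polarization_J L)"
    by (rule polarization_J_glinear[OF pol])
  show "x \<in> L k \<longleftrightarrow> x \<in> {x \<in> hc V k \<times> hc V k. cx_map (polarization_J L) x = cx_i x}"
  proof
    assume "x \<in> L k"
    then have a: "a \<in> hc V k" and b: "b = - polarization_J L a" and "b \<in> hc V k"
      using graph_iff[OF pol, of a b k] polarization_subset[OF pol, of k] unfolding x by blast+
    moreover have "polarization_J L b = a"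
      using glinear_minus[OF J polarization_J_mem[OF pol a]] polarization_J_square[OF pol a]
      by (simp add: b)
    ultimately show "x \<in> {x \<in> hc V k \<times> hc V k. cx_map (polarization_J L) x = cx_i x}"
      by (simp add: x cx_map_def cx_i_def)
  next
    assume "x \<in> {x \<in> hc V k \<times> hc V k. cx_map (polarization_J L) x = cx_i x}"
    then show "x \<in> L k"
      by (simp add: x cx_map_def cx_i_def graph_iff[OF pol])
  qed
qed

lemma polarization_conj_eigenspace:
  fixes L :: "int \<Rightarrow> ('v::real_vector \<times> 'v) set"
  assumes pol: "graded_polarization V L"
  shows "cx_conj ` L k = {x \<in> hc V k \<times> hc V k. cx_map (polarization_J L) x = - cx_i x}"
proof (rule set_eqI)
  fix x :: "'v \<times> 'v"
  obtain a b where x: "x = (a, b)" by (cases x)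
  have J: "glinear 0 V V (polarization_J L)"
    by (rule polarization_J_glinear[OF pol])
  have sub: "subspace (hc V k)"
    using pol graded_space_subspace unfolding graded_polarization_def by blast
  have "x \<in> cx_conj ` L k \<longleftrightarrow> (a, - b) \<in> L k"
    unfolding x cx_conj_def image_iff by force
  also have "\<dots> \<longleftrightarrow> a \<in> hc V k \<and> - b \<in> hc V k \<and> polarization_J L a = b \<and> polarization_J L (- b) = a"
    by (subst polarization_eigenspace[OF pol]) (auto simp: cx_map_def cx_i_def)
  also have "\<dots> \<longleftrightarrow> a \<in> hc V k \<and> b \<in> hc V k \<and> polarization_J L a = b \<and> polarization_J L b = - a"
  proof -
    have "- b \<in> hc V k \<longleftrightarrow> b \<in> hc V k"
      using subspace_neg[OF sub] by (metis minus_minus)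
    moreover have "polarization_J L (- b) = a \<longleftrightarrow> polarization_J L b = - a" if "b \<in> hc V k"
      using glinear_minus[OF J that] by (metis minus_minus)
    ultimately show ?thesis by blast
  qed
  finally show "x \<in> cx_conj ` L k \<longleftrightarrow>
      x \<in> {x \<in> hc V k \<times> hc V k. cx_map (polarization_J L) x = - cx_i x}"
    by (simp add: x cx_map_def cx_i_def)
qed


section \<open>Isotropic and involutive polarizations\<close>

lemma gdeg_minus:
  assumes "graded_space P"
  shows "gdeg P (- x) = gdeg P x"
proof -
  have "- x \<in> hc P k \<longleftrightarrow> x \<in> hc P k" for k
    using subspace_neg[OF graded_space_subspace[OF assms]] by (metis minus_minus)
  then show ?thesis
    unfolding gdeg_def by simp
qed

text \<open>
  The pairing carries a sign that depends on the degree of its first argument, so this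
  needs more than the bilinearity of \<open>g\<close>: \<open>- x\<close> and \<open>x\<close> are assigned the same degree.
\<close>

lemma pairing_minus_minus:
  assumes P: "graded_space P" and g: "fiberwise_metric R ell P g"
    and x: "x \<in> hc P p" and y: "y \<in> hc P q"
  shows "pairing ell P g (- x) (- y) = pairing ell P g x y"
proof -
  have lin: "glinear ell P (gdual R P) g"
    using g unfolding fiberwise_metric_def module_map_def by blast
  have "g (- x) = - g x"
    using glinear_minus[OF lin x] .
  moreover have "glinear (p + ell) P (regular_module R) (g x)"
    using glinear_mem[OF lin x] unfolding gdual_def module_map_def by simp
  then have "g x (- y) = - g x y"
    using glinear_minus y by blast
  ultimately show ?thesis
    unfolding pairing_def gdeg_minus[OF P] by simp
qed

text \<open>Orthogonality is the real part of isotropy on the graph.\<close>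

lemma isotropic_orthogonal:
  assumes pol: "graded_polarization P L" and g: "fiberwise_metric R ell P g"
    and iso: "\<And>p q x y. x \<in> L p \<Longrightarrow> y \<in> L q \<Longrightarrow> cx_bilin (pairing ell P g) x y = 0"
    and x: "x \<in> hc P p" and y: "y \<in> hc P q"
  shows "pairing ell P g (polarization_J L x) (polarization_J L y) = pairing ell P g x y"
proof -
  have P: "graded_space P"
    using pol unfolding graded_polarization_def by blast
  have "fst (cx_bilin (pairing ell P g) (x, - polarization_J L x) (y, - polarization_J L y)) = 0"
    using iso[OF polarization_J_graph[OF pol x] polarization_J_graph[OF pol y]] by simp
  then show ?thesis
    using pairing_minus_minus[OF P g polarization_J_mem[OF pol x] polarization_J_mem[OF pol y]]
    by (simp add: cx_bilin_def)
qed

text \<open>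
  The bracket \<open>u - i w\<close> of two elements of the graph lies on the graph again, which determines
  its imaginary part: \<open>w = J u\<close>.
\<close>

lemma involutive_nijenhuis_zero:
  assumes pol: "graded_polarization P L" and br: "gbilinear ell P P P br"
    and inv: "\<And>p q x y. x \<in> L p \<Longrightarrow> y \<in> L q \<Longrightarrow> cx_bilin br x y \<in> L (p + q + ell)"
    and x: "x \<in> hc P p" and y: "y \<in> hc P q"
  shows "nijenhuis br (polarization_J L) x y = 0"
proof -
  let ?J = "polarization_J L"
  note Jx = polarization_J_mem[OF pol x] and Jy = polarization_J_mem[OF pol y]
  have sub: "subspace (hc P k)" for k
    using pol graded_space_subspace unfolding graded_polarization_def by blast
  have minus_Jy: "- ?J y \<in> hc P q"
    using subspace_neg[OF sub Jy] .
  define u where "u = br x y - br (?J x) (?J y)"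
  define w where "w = br x (?J y) + br (?J x) y"
  have u: "u \<in> hc P (p + q + ell)"
    unfolding u_def
    by (rule subspace_diff[OF sub gbilinear_mem[OF br x y] gbilinear_mem[OF br Jx Jy]])
  have "cx_bilin br (x, - ?J x) (y, - ?J y) = (u, - w)"
    using gbilinear_minus_left[OF br Jx minus_Jy] gbilinear_minus_left[OF br Jx y]
      gbilinear_minus_right[OF br x Jy] gbilinear_minus_right[OF br Jx Jy]
    by (simp add: cx_bilin_def u_def w_def)
  then have "(u, - w) \<in> L (p + q + ell)"
    using inv[OF polarization_J_graph[OF pol x] polarization_J_graph[OF pol y]] by simp
  then have "?J u = w"
    by (rule polarization_J_eqI[OF pol])
  then have "?J w = - u"
    using polarization_J_square[OF pol u] by simp
  then show ?thesis
    by (simp add: nijenhuis_def u_def w_def)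
qed


section \<open>Polarizations from complex subbundles\<close>

lemma complex_scalar_action:
  assumes M: "graded_module R P" and R: "graded_algebra R"
    and f: "f \<in> hc R p" and a: "a \<in> hc P k" and b: "b \<in> hc P k"
  shows "gsmul (cx_mod P) (f, 0) (a, b) = (gsmul P f a, gsmul P f b)"
    and "gsmul (cx_mod P) (0, gone R) (a, b) = cx_i (a, b)"
proof -
  have bil: "gbilinear 0 R P P (gsmul P)"
    using M unfolding graded_module_def by blast
  have zero: "gsmul P 0 a = 0" "gsmul P 0 b = 0"
    using gbilinear_zero_left[OF bil f] a b by blast+
  have "gsmul P (gone R) a = a" "gsmul P (gone R) b = b"
    using M homogI[OF a] homogI[OF b] unfolding graded_module_def by blast+
  then show "gsmul (cx_mod P) (f, 0) (a, b) = (gsmul P f a, gsmul P f b)"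
    and "gsmul (cx_mod P) (0, gone R) (a, b) = cx_i (a, b)"
    by (simp_all add: cx_mod_def cx_bilin_def cx_i_def zero)
qed

text \<open>
  A complex subbundle is a module over the complexified functions, which contain \<open>i\<close> as the
  pair \<open>(0, 1)\<close>; hence its sections are stable under \<open>cx_i\<close>. The real functions \<open>(f, 0)\<close> act
  componentwise, which is what makes \<open>J\<close> linear over them.
\<close>

lemma complex_subbundle_polarization:
  assumes A: "algebra_sheaf X A" and E: "module_sheaf X A E"
    and L: "complex_subbundle X A E L" and U: "openin X U"
    and split: "\<And>k. hc (sect (cx_mod_sheaf E) U) k =
                     {x + y | x y. x \<in> L U k \<and> y \<in> conj_subsheaf L U k} \<and>
                   L U k \<inter> conj_subsheaf L U k = {0}"
  shows "graded_polarization (sect E U) (L U)"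
    and "\<And>f p a b k. f \<in> hc (sect A U) p \<Longrightarrow> (a, b) \<in> L U k \<Longrightarrow>
           (gsmul (sect E U) f a, gsmul (sect E U) f b) \<in> L U (p + k)"
proof -
  let ?R = "sect A U" and ?P = "sect E U"
  have R: "graded_algebra ?R" and M: "graded_module ?R ?P"
    using A E U unfolding algebra_sheaf_def module_sheaf_def by blast+
  have gs: "graded_space ?R"
    using R unfolding graded_algebra_def by blast
  have one: "gone ?R \<in> hc ?R 0"
    using R unfolding graded_algebra_def by blast
  have zero: "0 \<in> hc ?R p" for p
    using subspace_0[OF graded_space_subspace[OF gs]] .
  have LM: "graded_module (cx_alg ?R) ((cx_mod ?P)\<lparr>hc := L U\<rparr>)"
    using L U unfolding complex_subbundle_def module_sheaf_def
    by (auto simp: restrict_sheaf_def cx_mod_sheaf_def cx_alg_sheaf_def)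
  have sub: "subspace (L U k)" for k
    using LM graded_space_subspace[of "(cx_mod ?P)\<lparr>hc := L U\<rparr>" k]
    unfolding graded_module_def by simp
  have mem: "L U k \<subseteq> hc ?P k \<times> hc ?P k" for k
    using L U unfolding complex_subbundle_def by (simp add: cx_mod_sheaf_def cx_mod_def)
  have act: "gsmul (cx_mod ?P) (f, h) x \<in> L U (p + k)"
    if "f \<in> hc ?R p" "h \<in> hc ?R p" "x \<in> L U k" for f h x p k
  proof -
    have "gbilinear 0 (cx_alg ?R) ((cx_mod ?P)\<lparr>hc := L U\<rparr>) ((cx_mod ?P)\<lparr>hc := L U\<rparr>)
            (gsmul (cx_mod ?P))"
      using LM unfolding graded_module_def by simp
    from gbilinear_mem[OF this, of "(f, h)" p x k] that show ?thesis
      by (simp add: cx_alg_def)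
  qed
  show "(gsmul ?P f a, gsmul ?P f b) \<in> L U (p + k)"
    if "f \<in> hc ?R p" "(a, b) \<in> L U k" for f p a b k
  proof -
    have "a \<in> hc ?P k" "b \<in> hc ?P k"
      using mem[of k] that(2) by auto
    then show ?thesis
      using act[OF that(1) zero that(2)] complex_scalar_action(1)[OF M R that(1)] by simp
  qed
  have "cx_i x \<in> L U k" if "x \<in> L U k" for x k
  proof -
    have "fst x \<in> hc ?P k" "snd x \<in> hc ?P k"
      using mem[of k] that by auto
    then show ?thesis
      using act[OF zero one that] complex_scalar_action(2)[OF M R one, of "fst x" k "snd x"] by simp
  qed
  moreover have "graded_space ?P"
    using M unfolding graded_module_def by blast
  ultimately show "graded_polarization ?P (L U)"
    using sub split unfolding graded_polarization_def
    by (simp add: cx_mod_sheaf_def cx_mod_def conj_subsheaf_def)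
qed

lemma polarization_J_module_map:
  assumes pol: "graded_polarization P L"
    and act: "\<And>f p a b k. f \<in> hc R p \<Longrightarrow> (a, b) \<in> L k \<Longrightarrow> (gsmul P f a, gsmul P f b) \<in> L (p + k)"
    and bil: "gbilinear 0 R P P (gsmul P)"
  shows "module_map R 0 P P (polarization_J L)"
proof -
  have "polarization_J L (gsmul P f x) = gsmul P f (polarization_J L x)"
    if f: "f \<in> hc R p" and x: "x \<in> hc P k" for f x p k
    using act[OF f polarization_J_graph[OF pol x]]
      gbilinear_minus_right[OF bil f polarization_J_mem[OF pol x]]
    by (intro polarization_J_eqI[OF pol, where k = "p + k"]) simp
  then show ?thesis
    unfolding module_map_def using polarization_J_glinear[OF pol]
    by (auto simp: ksign_def elim!: homogE)
qed

lemma glinear_res: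
  assumes "graded_sheaf X S" and "openin X U" "openin X V" "V \<subseteq> U"
  shows "glinear 0 (sect S U) (sect S V) (res S U V)"
  using assms(1)[unfolded graded_sheaf_def, THEN conjunct2, THEN conjunct1] assms(2-4) by blast

lemma complex_subbundle_restrict:
  assumes L: "complex_subbundle X A E L"
    and "openin X U" "openin X V" "V \<subseteq> U" and "(a, b) \<in> L U k"
  shows "(res E U V a, res E U V b) \<in> L V k"
proof -
  have "graded_sheaf X (restrict_sheaf (cx_mod_sheaf E) L)"
    using L unfolding complex_subbundle_def module_sheaf_def by blast
  from glinear_res[OF this assms(2-4)]
  have "glinear 0 ((cx_mod (sect E U))\<lparr>hc := L U\<rparr>) ((cx_mod (sect E V))\<lparr>hc := L V\<rparr>)
          (cx_map (res E U V))"
    by (simp add: restrict_sheaf_def cx_mod_sheaf_def)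
  from glinear_mem[OF this, of "(a, b)" k] assms(5) show ?thesis
    by (simp add: cx_map_def)
qed

lemma polarization_J_restrict:
  assumes polU: "graded_polarization (sect E U) (L U)"
    and polV: "graded_polarization (sect E V) (L V)"
    and L: "complex_subbundle X A E L" and E: "module_sheaf X A E"
    and UV: "openin X U" "openin X V" "V \<subseteq> U" and s: "s \<in> hc (sect E U) k"
  shows "polarization_J (L V) (res E U V s) = res E U V (polarization_J (L U) s)"
proof (rule polarization_J_eqI[OF polV])
  have "graded_sheaf X E"
    using E unfolding module_sheaf_def by (rule conjunct1)
  then have lin: "glinear 0 (sect E U) (sect E V) (res E U V)"
    using UV by (rule glinear_res)
  show "(res E U V s, - res E U V (polarization_J (L U) s)) \<in> L V k"
    using complex_subbundle_restrict[OF L UV polarization_J_graph[OF polU s]]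
      glinear_minus[OF lin polarization_J_mem[OF polU s]] by simp
qed


section \<open>The complex structure of a generalized complex structure\<close>

theorem proposition4p3:
  fixes X :: "'x topology"
    and A :: "('x, 'f::real_vector) alg_sheaf"
    and E :: "('x, 'f, 'v::real_vector) mod_sheaf"
    and ell :: int
    and \<rho> :: "'v \<Rightarrow> 'f \<Rightarrow> 'f"
    and g :: "'v \<Rightarrow> 'v \<Rightarrow> 'f"
    and br :: "'v \<Rightarrow> 'v \<Rightarrow> 'v"
    and L :: "'x set \<Rightarrow> int \<Rightarrow> ('v \<times> 'v) set"
  assumes "graded_manifold X A"
    and "graded_courant_algebroid X A ell E \<rho> g br"
    and "generalized_complex_structure X A ell E g br L"
  defines "R \<equiv> global_sections X A"
    and "P \<equiv> global_sections X E"
  shows "\<exists>J JU. module_map R 0 P P J \<and> sheaf_extension X A 0 E E J JU \<and>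
     (\<forall>x\<in>homog P. J (J x) = - x) \<and>
     (\<forall>x\<in>homog P. \<forall>y\<in>homog P. pairing ell P g (J x) (J y) = pairing ell P g x y) \<and>
     (\<forall>x\<in>homog P. \<forall>y\<in>homog P. nijenhuis br J x y = 0) \<and>
     (\<forall>U. openin X U \<longrightarrow>
        (\<forall>k. L U k = {x \<in> hc (sect (cx_mod_sheaf E) U) k. cx_map (JU U) x = cx_i x} \<and>
             conj_subsheaf L U k =
               {x \<in> hc (sect (cx_mod_sheaf E) U) k. cx_map (JU U) x = - cx_i x}))"
proof -
  have A: "algebra_sheaf X A"
    using assms(1) unfolding graded_manifold_def by blast
  have E: "module_sheaf X A E" and g: "fiberwise_metric R ell P g" and br: "gbilinear ell P P P br"
    using assms(2) unfolding graded_courant_algebroid_def graded_vector_bundle_def R_def P_def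
    by (auto simp: Let_def)
  note gcs = assms(3)[unfolded generalized_complex_structure_def, folded P_def]
  have L: "complex_subbundle X A E L"
    using gcs by (rule conjunct1)
  have iso: "\<And>p q x y. x \<in> L (topspace X) p \<Longrightarrow> y \<in> L (topspace X) q \<Longrightarrow>
                cx_bilin (pairing ell P g) x y = 0"
    using gcs[THEN conjunct2, THEN conjunct1] by blast
  have inv: "\<And>p q x y. x \<in> L (topspace X) p \<Longrightarrow> y \<in> L (topspace X) q \<Longrightarrow>
                cx_bilin br x y \<in> L (topspace X) (p + q + ell)"
    using gcs[THEN conjunct2, THEN conjunct2, THEN conjunct1] by blast
  have split: "\<And>U k. openin X U \<Longrightarrow>
                  hc (sect (cx_mod_sheaf E) U) k =
                    {x + y | x y. x \<in> L U k \<and> y \<in> conj_subsheaf L U k} \<and>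
                  L U k \<inter> conj_subsheaf L U k = {0}"
    using gcs[THEN conjunct2, THEN conjunct2, THEN conjunct2] by simp
  define JU where "JU U = polarization_J (L U)" for U
  have pol: "graded_polarization (sect E U) (L U)" if "openin X U" for U
    using complex_subbundle_polarization(1)[OF A E L that split[OF that]] .
  have polP: "graded_polarization P (L (topspace X))"
    using pol[OF openin_topspace] by (simp add: P_def global_sections_def)
  have map: "module_map (sect A U) 0 (sect E U) (sect E U) (JU U)" if U: "openin X U" for U
    unfolding JU_def
  proof (rule polarization_J_module_map[OF pol[OF U]])
    show "gbilinear 0 (sect A U) (sect E U) (sect E U) (gsmul (sect E U))"
      using E U unfolding module_sheaf_def graded_module_def by blast
  qed (rule complex_subbundle_polarization(2)[OF A E L U split[OF U]])
  have ext: "sheaf_extension X A 0 E E (JU (topspace X)) JU"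
    unfolding sheaf_extension_def using map
    by (auto simp: JU_def elim!: homogE intro!: polarization_J_restrict[OF pol pol L E])
  have map_global: "module_map R 0 P P (JU (topspace X))"
    using map[OF openin_topspace] by (simp add: R_def P_def global_sections_def)
  have square: "\<forall>x\<in>homog P. JU (topspace X) (JU (topspace X) x) = - x"
    unfolding JU_def by (auto elim!: homogE intro: polarization_J_square[OF polP])
  have orthogonal: "\<forall>x\<in>homog P. \<forall>y\<in>homog P.
      pairing ell P g (JU (topspace X) x) (JU (topspace X) y) = pairing ell P g x y"
    unfolding JU_def by (auto elim!: homogE intro: isotropic_orthogonal[OF polP g iso])
  have nijenhuis: "\<forall>x\<in>homog P. \<forall>y\<in>homog P. nijenhuis br (JU (topspace X)) x y = 0"
    unfolding JU_def by (auto elim!: homogE intro: involutive_nijenhuis_zero[OF polP br inv])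
  have eigenspaces: "L U k = {x \<in> hc (sect (cx_mod_sheaf E) U) k. cx_map (JU U) x = cx_i x} \<and>
      conj_subsheaf L U k = {x \<in> hc (sect (cx_mod_sheaf E) U) k. cx_map (JU U) x = - cx_i x}"
    if U: "openin X U" for U k
    using polarization_eigenspace[OF pol[OF U], of k]
      polarization_conj_eigenspace[OF pol[OF U], of k]
    by (simp add: JU_def conj_subsheaf_def cx_mod_sheaf_def cx_mod_def)
  show ?thesis
    by (intro exI[of _ "JU (topspace X)"] exI[of _ JU] conjI allI impI
        map_global ext square orthogonal nijenhuis eigenspaces[THEN conjunct1]
        eigenspaces[THEN conjunct2])
qed

end
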